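(* Let $\Omega \subseteq \mathbb{R}$ be an $\omega$-monoid. Then $\Omega$ is a scalar multiple of a numerical semigroup or a scalar multiple of a normalized tempered monoid. That is, at least one of the following holds: (a) there exist a real number $c$ and a numerical semigroup $S$ such that $\Omega = cS = \{cs : s \in S\}$; (b) there exist a real number $c$ and a normalized tempered monoid $T$ such that $\Omega = cT = \{ct : t\in T\}$.
   Context: Here $\mathbb{N}=\{1,2,\dots\}$ and $\mathbb{N}_0=\mathbb{N}\cup\{0\}$. An $\omega$-monoid is a submonoid of $(\mathbb{R},+)$ that is increasingly enumerable, i.e., of order type $\omega$. Explicitly, it is a set $\Omega=\{a_0,a_1,a_2,\dots\}\subseteq\mathbb{R}$, where $(a_i)_{i\in\mathbb{N}_0}$ is an infinite sequence with $a_i<a_{i+1}$ for all $i\geq 0$, such that (i) $a_0=0$ and (ii) $a_i+a_j\in\Omega$ for all positive integers $i,j$. A numerical semigroup is a subset $S\subseteq\mathbb{N}_0$ such that (i) $0\in S$, (ii) $a+b\in S$ whenever $a,b\in S$, and (iii) $\mathbb{N}_0\setminus S$ is finite. A tempered monoid is the set $T$ of elements of an infinite strictly increasing sequence $\tau_0<\tau_1<\tau_2<\cdots$ of nonnegative real numbers such that (i) $\tau_0=0$, (ii) $\tau_i+\tau_j\in T$ for all positive integers $i,j$, and (iii) $\lim_{n\to\infty}(\tau_{n+1}-\tau_n)=0$. It is normalized if $\tau_1=1$. *)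

theory Defs
  imports "HOL-Analysis.Analysis"
begin

definition omega_monoid :: "real set \<Rightarrow> bool" where
  "omega_monoid \<Omega> \<longleftrightarrow>
     (\<exists>a :: nat \<Rightarrow> real. strict_mono a \<and> \<Omega> = range a \<and> a 0 = 0 \<and>
        (\<forall>i j. 0 < i \<longrightarrow> 0 < j \<longrightarrow> a i + a j \<in> \<Omega>))"

definition numerical_semigroup :: "nat set \<Rightarrow> bool" where
  "numerical_semigroup S \<longleftrightarrow>
     0 \<in> S \<and> (\<forall>a b. a \<in> S \<longrightarrow> b \<in> S \<longrightarrow> a + b \<in> S) \<and> finite (- S)"

definition tempered_enumeration :: "(nat \<Rightarrow> real) \<Rightarrow> real set \<Rightarrow> bool" where
  "tempered_enumeration \<tau> T \<longleftrightarrow>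
     strict_mono \<tau> \<and> (\<forall>n. 0 \<le> \<tau> n) \<and> T = range \<tau> \<and> \<tau> 0 = 0 \<and>
     (\<forall>i j. 0 < i \<longrightarrow> 0 < j \<longrightarrow> \<tau> i + \<tau> j \<in> T) \<and>
     (\<lambda>n. \<tau> (Suc n) - \<tau> n) \<longlonglongrightarrow> 0"

(* A set has at most one strictly increasing enumeration by the natural numbers,
   so the condition on the first nonzero element does not depend on the choice of the sequence. *)
definition normalized_tempered_monoid :: "real set \<Rightarrow> bool" where
  "normalized_tempered_monoid T \<longleftrightarrow> (\<exists>\<tau>. tempered_enumeration \<tau> T \<and> \<tau> 1 = 1)"

end

theory Submission
  imports Defs
begin

text \<open>
  The differences of elements of \<open>\<Omega>\<close> form a subgroup of the reals, so they either have arbitrarily small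
  positive elements or are the integer multiples of some \<open>d > 0\<close>. In the second case \<open>\<Omega> = d S\<close>, and \<open>S\<close>
  contains two consecutive numbers, hence all large ones. In the first case let \<open>\<delta> = x - y\<close> be a small
  difference and \<open>m\<close> a positive element of \<open>\<Omega>\<close>. The elements \<open>k x + (N - k) y = N y + k \<delta>\<close> are spaced by
  \<open>\<delta>\<close> on an interval of length \<open>N \<delta> \<ge> m\<close>; translating by multiples of \<open>m\<close> shows that all gaps beyond
  \<open>N y\<close> are at most \<open>\<delta>\<close>.
\<close>

text \<open>Stated over a semiring so that it provides the natural multiples both of reals and of
  elements of a set of naturals.\<close>

lemma of_nat_mult_mem_add_closed:
  fixes A :: "'a::semiring_1 set"
  assumes "0 \<in> A" and "\<And>x y. x \<in> A \<Longrightarrow> y \<in> A \<Longrightarrow> x + y \<in> A" and "x \<in> A"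
  shows "of_nat n * x \<in> A"
  by (induction n) (use assms in \<open>auto simp: algebra_simps\<close>)

lemma add_closed_near_right:
  fixes A :: "real set"
  assumes zero: "0 \<in> A" and add: "\<And>x y. x \<in> A \<Longrightarrow> y \<in> A \<Longrightarrow> x + y \<in> A"
    and m: "m \<in> A" "0 < m" and xy: "x \<in> A" "y \<in> A" "y < x"
  shows "\<exists>B. \<forall>z\<ge>B. \<exists>w\<in>A. z < w \<and> w \<le> z + (x - y)"
proof -
  have mult: "real n * u \<in> A" if "u \<in> A" for n u
    using of_nat_mult_mem_add_closed[OF zero add that] .
  define \<delta> where "\<delta> = x - y"
  \<comment> \<open>The extra 1 leaves room for the rounding up in \<open>k\<close> below, which may
    exceed \<open>r / \<delta>\<close> by a full unit.\<close>
  define N where "N = nat \<lceil>m / \<delta>\<rceil> + 1"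
  have \<delta>: "0 < \<delta>" using xy by (simp add: \<delta>_def)
  have "m / \<delta> \<le> real N - 1" unfolding N_def by linarith
  then have N: "m \<le> (real N - 1) * \<delta>" using \<delta> by (simp add: pos_divide_le_eq)
  have "\<exists>w\<in>A. z < w \<and> w \<le> z + \<delta>" if z: "z \<ge> real N * y" for z
  proof -
    define u where "u = z - real N * y"
    \<comment> \<open>Division with remainder: \<open>z - q * m = N * y + r\<close> with
      \<open>0 \<le> r < m\<close>, so \<open>z\<close> is moved back into one period of length
      \<open>m\<close> starting at \<open>N * y\<close>.\<close>
    define q where "q = nat \<lfloor>u / m\<rfloor>"
    define r where "r = u - real q * m"
    \<comment> \<open>The least \<open>k\<close> with \<open>r < k * \<delta>\<close>; rounding
      strictly up makes \<open>w\<close> strictly larger than \<open>z\<close>.\<close>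
    define k where "k = nat \<lfloor>r / \<delta>\<rfloor> + 1"
    have "0 \<le> u / m" using z m by (simp add: u_def)
    then have "real q \<le> u / m" "u / m < real q + 1" unfolding q_def by linarith+
    then have r: "0 \<le> r" "r < m" using m by (simp_all add: r_def field_simps)
    then have "0 \<le> r / \<delta>" using \<delta> by simp
    then have "real k - 1 \<le> r / \<delta>" "r / \<delta> < real k" unfolding k_def by linarith+
    then have k: "(real k - 1) * \<delta> \<le> r" "r < real k * \<delta>" using \<delta> by (simp_all add: field_simps)
    then have "(real k - 1) * \<delta> < (real N - 1) * \<delta>" using r N by linarith
    \<comment> \<open>This bound keeps the subtraction \<open>N - k\<close> in \<open>w\<close> from
      being truncated.\<close>
    then have kN: "k \<le> N" using \<delta> by simp
    define w where "w = real k * x + real (N - k) * y + real q * m"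
    have "w \<in> A" unfolding w_def using add mult xy m by blast
    moreover have w: "w = z - r + real k * \<delta>"
      using kN by (simp add: w_def r_def u_def \<delta>_def of_nat_diff algebra_simps)
    moreover have "z < w" "w \<le> z + \<delta>" using k by (simp_all add: w left_diff_distrib)
    ultimately show ?thesis by blast
  qed
  then show ?thesis unfolding \<delta>_def by blast
qed

text \<open>Distinct elements of \<open>D\<close> are at least \<open>e\<close> apart, so the
  infimum of the positive ones is attained, at some \<open>d\<close>. Division by \<open>d\<close>
  leaves a remainder in \<open>D\<close> that is smaller than \<open>d\<close>, hence zero.\<close>

lemma real_subgroup_discrete:
  fixes D :: "real set"
  assumes zero: "0 \<in> D" and diff: "\<And>x y. x \<in> D \<Longrightarrow> y \<in> D \<Longrightarrow> x - y \<in> D"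
    and m: "m \<in> D" "0 < m"
    and gap: "0 < e" "\<And>x. x \<in> D \<Longrightarrow> 0 < x \<Longrightarrow> e \<le> x"
  obtains d where "d \<in> D" "0 < d" "\<forall>x\<in>D. \<exists>k::int. x = of_int k * d"
proof -
  define P where "P = {x \<in> D. 0 < x}"
  define i where "i = Inf P"
  have ne: "P \<noteq> {}" using m by (auto simp: P_def)
  have bdd: "bdd_below P" by (rule bdd_belowI[of _ 0]) (auto simp: P_def)
  have "e \<le> i" unfolding i_def using ne by (rule cInf_greatest) (auto simp: P_def gap(2))
  then have i: "0 < i" using gap(1) by linarith
  have low: "i \<le> x" if "x \<in> P" for x unfolding i_def using that bdd by (rule cInf_lower)
  obtain d where d: "d \<in> P" "d < i + e"
    using cInf_lessD[OF ne, of "i + e"] gap(1) by (auto simp: i_def)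
  \<comment> \<open>An element of \<open>P\<close> below \<open>d\<close> would differ from \<open>d\<close> by less than \<open>e\<close>.\<close>
  have min: "d \<le> x" if "x \<in> D" "0 < x" for x
  proof (rule ccontr)
    assume "\<not> d \<le> x"
    then have "e \<le> d - x" using d that by (intro gap(2) diff) (auto simp: P_def)
    moreover have "i \<le> x" using that low by (auto simp: P_def)
    ultimately show False using d by linarith
  qed
  have dD: "d \<in> D" and d0: "0 < d" using d by (auto simp: P_def)
  have neg: "- x \<in> D" if "x \<in> D" for x using diff[OF zero that] by simp
  have add: "x + y \<in> D" if "x \<in> D" "y \<in> D" for x y using diff[OF that(1) neg[OF that(2)]] by simp
  have nat_mult: "real n * d \<in> D" for n
    using of_nat_mult_mem_add_closed[OF zero add dD] .
  have int_mult: "of_int k * d \<in> D" for k :: int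
  proof (cases k rule: int_cases2)
    case (nonneg n)
    then show ?thesis using nat_mult[of n] by simp
  next
    case (nonpos n)
    then show ?thesis using neg[OF nat_mult[of n]] by simp
  qed
  have "\<exists>k::int. x = of_int k * d" if x: "x \<in> D" for x
  proof
    \<comment> \<open>The remainder \<open>x - k * d\<close> lies in \<open>[0, d)\<close> and in
      \<open>D\<close>; minimality of \<open>d\<close> excludes a positive value.\<close>
    define k where "k = \<lfloor>x / d\<rfloor>"
    have "of_int k \<le> x / d" "x / d < of_int k + 1" unfolding k_def by linarith+
    then have "0 \<le> x - of_int k * d" "x - of_int k * d < d" using d0 by (simp_all add: field_simps)
    then show "x = of_int k * d" using min[OF diff[OF x int_mult[of k]]] by linarith
  qed
  with dD d0 show thesis using that by blast
qed

text \<open>Write \<open>n = a * p + r\<close> with \<open>r < p\<close>. Once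
  \<open>n \<ge> p * p\<close>, the quotient satisfies \<open>a \<ge> p > r\<close>, so
  \<open>r\<close> of the \<open>a\<close> copies of \<open>p\<close> can absorb the remainder by
  becoming \<open>Suc p\<close>.\<close>

lemma numerical_semigroupI_consecutive:
  assumes zero: "0 \<in> S" and add: "\<And>a b. a \<in> S \<Longrightarrow> b \<in> S \<Longrightarrow> a + b \<in> S"
    and p: "p \<in> S" "Suc p \<in> S"
  shows "numerical_semigroup S"
proof -
  have mult: "n * x \<in> S" if "x \<in> S" for n x
    using of_nat_mult_mem_add_closed[OF zero add that, of n] by simp
  have "n \<in> S" if n: "p * p \<le> n" for n
  \<comment> \<open>For \<open>p = 0\<close> there is no division by \<open>p\<close>, but then
    \<open>Suc p = 1\<close> already generates everything.\<close>
  proof (cases "p = 0")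
    case True
    then show ?thesis using mult[OF p(2), of n] by simp
  next
    case False
    define a where "a = n div p"
    define r where "r = n mod p"
    have "p \<le> a" using div_le_mono[OF n, of p] False by (simp add: a_def)
    moreover have "r < p" using False by (simp add: r_def)
    ultimately obtain b where b: "a = b + r" by (metis le_add_diff_inverse2 less_imp_le order_trans)
    have "n = a * p + r" by (simp add: a_def r_def)
    also have "\<dots> = b * p + r * Suc p" by (simp add: b algebra_simps)
    also have "\<dots> \<in> S" using add mult p by blast
    finally show ?thesis .
  qed
  then have "- S \<subseteq> {..<p * p}" by (auto simp: not_le[symmetric])
  then have "finite (- S)" by (rule finite_subset) simp
  then show ?thesis using zero add by (auto simp: numerical_semigroup_def)
qed

text \<open>\<open>a (Suc n)\<close> is the least value above \<open>a n\<close>, so any value found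
  shortly after \<open>a n\<close> bounds the gap. Unboundedness ensures that \<open>a n\<close>
  eventually passes the threshold \<open>B\<close>.\<close>

lemma gaps_tendsto_zero:
  fixes a :: "nat \<Rightarrow> real"
  assumes mono: "strict_mono a" and unbounded: "\<And>B. \<exists>n. B \<le> a n"
    and near: "\<And>e. 0 < e \<Longrightarrow> \<exists>B. \<forall>z\<ge>B. \<exists>w\<in>range a. z < w \<and> w \<le> z + e"
  shows "(\<lambda>n. a (Suc n) - a n) \<longlonglongrightarrow> 0"
proof (rule LIMSEQ_I)
  fix e :: real assume "0 < e"
  then obtain B where B: "\<And>z. z \<ge> B \<Longrightarrow> \<exists>w\<in>range a. z < w \<and> w \<le> z + e / 2"
    using near[of "e / 2"] by auto
  obtain n0 where n0: "B \<le> a n0" using unbounded by blast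
  have "norm (a (Suc n) - a n - 0) < e" if "n0 \<le> n" for n
  proof -
    have "B \<le> a n" using n0 that mono by (meson order_trans strict_mono_less_eq)
    then obtain j where j: "a n < a j" "a j \<le> a n + e / 2" using B by blast
    then have "a (Suc n) \<le> a j" using mono by (simp add: strict_mono_less strict_mono_less_eq)
    moreover have "a n < a (Suc n)" using mono by (simp add: strict_mono_less)
    ultimately show ?thesis using j \<open>0 < e\<close> by simp
  qed
  then show "\<exists>n0. \<forall>n\<ge>n0. norm (a (Suc n) - a n - 0) < e" by blast
qed

theorem theorem10:
  fixes \<Omega> :: "real set"
  assumes "omega_monoid \<Omega>"
  shows "(\<exists>(c :: real) (S :: nat set). numerical_semigroup S \<and> \<Omega> = (\<lambda>s. c * real s) ` S) \<or>
         (\<exists>(c :: real) (T :: real set). normalized_tempered_monoid T \<and> \<Omega> = (\<lambda>t. c * t) ` T)"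
proof -
  obtain a :: "nat \<Rightarrow> real" where mono: "strict_mono a" and \<Omega>: "\<Omega> = range a" and a0: "a 0 = 0"
    and sums: "\<forall>i j. 0 < i \<longrightarrow> 0 < j \<longrightarrow> a i + a j \<in> \<Omega>"
    using assms unfolding omega_monoid_def by blast
  have zero: "0 \<in> \<Omega>" using a0 \<Omega> by (metis rangeI)
  have add: "x + y \<in> \<Omega>" if xy: "x \<in> \<Omega>" "y \<in> \<Omega>" for x y
  proof -
    obtain i j where "x = a i" "y = a j" using xy \<Omega> by auto
    then show ?thesis using sums a0 \<Omega> by (cases "i = 0"; cases "j = 0") auto
  qed
  have nonneg: "0 \<le> a n" for n using mono a0 by (metis le0 strict_mono_less_eq)
  define m where "m = a 1"
  have m: "m \<in> \<Omega>" "0 < m" using mono a0 strict_monoD[of a 0 1] by (auto simp: m_def \<Omega>)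
  \<comment> \<open>The subgroup generated by \<open>\<Omega>\<close>; whether it has arbitrarily
    small positive elements decides between the two alternatives.\<close>
  define D where "D = {x - y |x y. x \<in> \<Omega> \<and> y \<in> \<Omega>}"
  have diff: "u - v \<in> D" if uv: "u \<in> D" "v \<in> D" for u v
  proof -
    obtain x y x' y' where *: "x \<in> \<Omega>" "y \<in> \<Omega>" "x' \<in> \<Omega>" "y' \<in> \<Omega>" "u = x - y" "v = x' - y'"
      using uv unfolding D_def by blast
    then have "u - v = (x + y') - (y + x')" by simp
    with * add show ?thesis unfolding D_def by blast
  qed
  have sub: "x \<in> D" if "x \<in> \<Omega>" for x
    unfolding D_def using that zero by force
  show ?thesis
  proof (cases "\<forall>e>0. \<exists>u\<in>D. 0 < u \<and> u < e")
    case small: True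
    have near: "\<exists>B. \<forall>z\<ge>B. \<exists>w\<in>range a. z < w \<and> w \<le> z + e" if "0 < e" for e
    proof -
      obtain x y where xy: "x \<in> \<Omega>" "y \<in> \<Omega>" "y < x" "x - y < e"
        using small \<open>0 < e\<close> unfolding D_def by fastforce
      obtain B where B: "\<forall>z\<ge>B. \<exists>w\<in>\<Omega>. z < w \<and> w \<le> z + (x - y)"
        using add_closed_near_right[OF zero add m xy(1-3)] by blast
      show ?thesis
      proof (intro exI[of _ B] allI impI)
        fix z assume "B \<le> z"
        then obtain w where "w \<in> \<Omega>" "z < w" "w \<le> z + (x - y)" using B by blast
        then show "\<exists>w\<in>range a. z < w \<and> w \<le> z + e" using xy(4) \<Omega> by (intro bexI[of _ w]) auto
      qed
    qed
    have unbounded: "\<exists>n. B \<le> a n" for B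
    proof -
      \<comment> \<open>A strictly increasing sequence could be bounded; closure under addition
        rules this out through the multiples of \<open>m\<close>.\<close>
      obtain k where "B \<le> real k * m" using m(2) by (metis reals_Archimedean3 less_imp_le)
      moreover have "real k * m \<in> range a"
        using of_nat_mult_mem_add_closed[OF zero add m(1)] \<Omega> by simp
      ultimately show ?thesis by auto
    qed
    have "(\<lambda>n. a (Suc n) - a n) \<longlonglongrightarrow> 0" using mono unbounded near by (rule gaps_tendsto_zero)
    then have lim: "(\<lambda>n. (a (Suc n) - a n) / m) \<longlonglongrightarrow> 0" by (rule tendsto_divide_zero)
    \<comment> \<open>Since \<open>m = a 1\<close>, this rescaling gives
      \<open>\<tau> 1 = 1\<close>.\<close>
    define \<tau> where "\<tau> = (\<lambda>n. a n / m)"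
    have scale: "\<Omega> = (\<lambda>t. m * t) ` range \<tau>"
      using m(2) by (auto simp: \<Omega> \<tau>_def image_image)
    have "tempered_enumeration \<tau> (range \<tau>)"
      unfolding tempered_enumeration_def
    proof (intro conjI allI impI refl)
      show "strict_mono \<tau>"
        using mono m(2) by (auto simp: \<tau>_def strict_mono_def divide_strict_right_mono)
      show "0 \<le> \<tau> n" for n using nonneg m(2) by (simp add: \<tau>_def)
      show "\<tau> 0 = 0" by (simp add: \<tau>_def a0)
      show "\<tau> i + \<tau> j \<in> range \<tau>" if ij: "0 < i" "0 < j" for i j
      proof -
        obtain k where "a i + a j = a k" using sums ij \<Omega> by auto
        then have "\<tau> i + \<tau> j = \<tau> k" by (simp add: \<tau>_def add_divide_distrib[symmetric])
        then show ?thesis by simp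
      qed
      show "(\<lambda>n. \<tau> (Suc n) - \<tau> n) \<longlonglongrightarrow> 0" using lim by (simp add: \<tau>_def diff_divide_distrib)
    qed
    moreover have "\<tau> 1 = 1" using m(2) by (simp add: \<tau>_def m_def)
    ultimately have "normalized_tempered_monoid (range \<tau>)"
      unfolding normalized_tempered_monoid_def by (intro exI[of _ \<tau>] conjI)
    with scale show ?thesis by (intro disjI2 exI[of _ m] exI[of _ "range \<tau>"] conjI)
  next
    case False
    then obtain e where e: "0 < e" "\<And>u. u \<in> D \<Longrightarrow> 0 < u \<Longrightarrow> e \<le> u" by (meson not_le)
    obtain d where d: "d \<in> D" "0 < d" and disc: "\<forall>x\<in>D. \<exists>k::int. x = of_int k * d"
      by (rule real_subgroup_discrete[OF sub[OF zero] diff sub[OF m(1)] m(2) e])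
    have nat: "\<exists>n::nat. x = d * real n" if x: "x \<in> \<Omega>" for x
    proof -
      obtain k :: int where k: "x = of_int k * d" using disc sub[OF x] by blast
      moreover have "0 \<le> x" using x \<Omega> nonneg by auto
      ultimately have "0 \<le> k" using d(2) by (simp add: zero_le_mult_iff)
      then show ?thesis using k by (intro exI[of _ "nat k"]) simp
    qed
    define S where "S = {n. d * real n \<in> \<Omega>}"
    have scale: "\<Omega> = (\<lambda>s. d * real s) ` S"
    proof
      show "\<Omega> \<subseteq> (\<lambda>s. d * real s) ` S"
      proof
        fix x assume x: "x \<in> \<Omega>"
        obtain n where n: "x = d * real n" using nat[OF x] by blast
        then have "n \<in> S" using x by (simp add: S_def)
        with n show "x \<in> (\<lambda>s. d * real s) ` S" by (rule image_eqI)
      qed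
    qed (auto simp: S_def)
    \<comment> \<open>The generator \<open>d\<close> is itself a difference of two elements of
      \<open>\<Omega>\<close>; divided by \<open>d\<close>, these become consecutive members of
      \<open>S\<close>.\<close>
    obtain x y where xy: "x \<in> \<Omega>" "y \<in> \<Omega>" "d = x - y" using d(1) unfolding D_def by blast
    obtain p where p: "y = d * real p" using nat[OF xy(2)] by blast
    have "x = d * real (Suc p)" using xy(3) p by (simp add: algebra_simps)
    then have pS: "p \<in> S" "Suc p \<in> S" using xy(1,2) p unfolding S_def by simp_all
    have "numerical_semigroup S"
    proof (rule numerical_semigroupI_consecutive[OF _ _ pS])
      show "0 \<in> S" using zero by (simp add: S_def)
      show "i + j \<in> S" if "i \<in> S" "j \<in> S" for i j
        using that add by (simp add: S_def distrib_left)
    qed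
    with scale show ?thesis by (intro disjI1 exI[of _ d] exI[of _ S] conjI)
  qed
qed

end
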